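(* For every $n\ge 1$, the $\lceil n/2\rceil$ level of the Lasserre hierarchy for the cut polytope $\mathrm{CUT}_n$ is exact, i.e. $Q_{\lceil n/2\rceil}=\mathrm{CUT}_n$.
   Context: The cut polytope is $\mathrm{CUT}_n=\mathrm{conv}\{(x_ix_j)_{1\le i<j\le n}:x\in\{-1,1\}^n\}\subset\mathbb R^{\binom n2}$. For $t\ge1$, the $t$-th level of the Lasserre hierarchy for $\mathrm{CUT}_n$ is the set $Q_t\subseteq\mathbb R^{\binom n2}$ of all $(\ell_{ij})_{1\le i<j\le n}$ for which there exist real numbers $y_U$, indexed by subsets $U\subseteq[n]=\{1,\dots,n\}$ with $|U|\le 2t$, such that $y_\emptyset=1$, $y_{\{i,j\}}=\ell_{ij}$ for all $i<j$, and the real symmetric matrix $[y_{S\triangle T}]$, with rows and columns indexed by all subsets $S,T\subseteq[n]$ of size at most $t$, is positive semidefinite. Here $S\triangle T$ is the symmetric difference. *)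

theory Defs
  imports "HOL-Analysis.Analysis" "HOL-Analysis.Finite_Function_Topology"
begin

definition index_pairs :: "nat \<Rightarrow> (nat \<times> nat) set" where
  "index_pairs n = {(i, j). 1 \<le> i \<and> i < j \<and> j \<le> n}"

lemma finite_index_pairs [simp]: "finite (index_pairs n)"
  by (rule finite_subset [of _ "{1..n} \<times> {1..n}"]) (auto simp: index_pairs_def)

text \<open>
  Since \<open>n\<close> is a variable, the coordinate space indexed by the pairs \<open>1 \<le> i < j \<le> n\<close> is
  represented by the finitely supported functions on \<open>nat \<times> nat\<close> (a real vector space with
  pointwise operations) whose support lies in \<open>index_pairs n\<close>.
\<close>

type_synonym pair_vector = "(nat \<times> nat, real) poly_mapping"

definition pair_space :: "nat \<Rightarrow> pair_vector set" where
  "pair_space n = {v. Poly_Mapping.keys v \<subseteq> index_pairs n}"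

definition cut_vector :: "nat \<Rightarrow> (nat \<Rightarrow> real) \<Rightarrow> pair_vector" where
  "cut_vector n x = (\<Sum>(i, j) \<in> index_pairs n. Poly_Mapping.single (i, j) (x i * x j))"

lemma lookup_cut_vector:
  "Poly_Mapping.lookup (cut_vector n x) (i, j) = (if (i, j) \<in> index_pairs n then x i * x j else 0)"
proof -
  have "Poly_Mapping.lookup (cut_vector n x) (i, j)
      = (\<Sum>p \<in> index_pairs n. if p = (i, j) then x i * x j else 0)"
    unfolding cut_vector_def lookup_sum
    by (rule sum.cong) (auto simp: lookup_single when_def split: if_splits)
  then show ?thesis
    by (simp add: sum.delta)
qed

definition cut_polytope :: "nat \<Rightarrow> pair_vector set" where
  "cut_polytope n = convex hull (cut_vector n ` {x. \<forall>i \<in> {1..n}. x i \<in> {-1, 1}})"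

text \<open>Intended for finite \<open>I\<close> only.\<close>

definition psd_on :: "'i set \<Rightarrow> ('i \<Rightarrow> 'i \<Rightarrow> real) \<Rightarrow> bool" where
  "psd_on I M \<longleftrightarrow>
     (\<forall>i \<in> I. \<forall>j \<in> I. M i j = M j i) \<and>
     (\<forall>c. 0 \<le> (\<Sum>i \<in> I. \<Sum>j \<in> I. c i * M i j * c j))"

text \<open>
  The real numbers indexed by the subsets of \<open>{1..n}\<close> of size at most \<open>2 * t\<close> are given by a
  total function \<open>y\<close> on sets; its values elsewhere are irrelevant, as a symmetric difference
  of two subsets of size at most \<open>t\<close> has size at most \<open>2 * t\<close>.
\<close>

definition lasserre_cut :: "nat \<Rightarrow> nat \<Rightarrow> pair_vector set" where
  "lasserre_cut n t =
     {l \<in> pair_space n. \<exists>y :: nat set \<Rightarrow> real.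
        y {} = 1 \<and>
        (\<forall>(i, j) \<in> index_pairs n. y {i, j} = Poly_Mapping.lookup l (i, j)) \<and>
        psd_on {S. S \<subseteq> {1..n} \<and> card S \<le> t} (\<lambda>S T. y (sym_diff S T))}"

end

theory Submission
  imports Defs
begin

text \<open>
  By separation it suffices to show that a quadratic function \<open>f \<ge> 0\<close> on the hypercube has
  nonnegative pseudo-expectation. The kernel \<open>f^(S \<triangle> T)\<close> of Fourier coefficients is positive
  semidefinite, since it is the Gram matrix of the characters weighted by \<open>f\<close>. Restricted to sets
  of one fixed parity it is block tridiagonal with respect to cardinality, so Gaussian elimination
  by increasing cardinality writes it as a sum of rank-one kernels, each supported on the sets of
  two consecutive cardinalities \<open>k\<close> and \<open>k + 2\<close>. If the parity is that of \<open>\<lfloor>n/2\<rfloor>\<close>, then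
  \<open>k + 2 \<le> \<lceil>n/2\<rceil>\<close> or \<open>n - k \<le> \<lceil>n/2\<rceil>\<close>; in the second case complementation, which preserves
  symmetric differences, moves the support into the sets of size at most \<open>\<lceil>n/2\<rceil>\<close>. Hence each
  rank-one kernel pairs nonnegatively with the moment matrix.
\<close>

subsection \<open>Positive semidefinite kernels\<close>

lemma sum_sum_mono_neutral_right:
  assumes "finite A" "B \<subseteq> A"
    and "\<And>i j. i \<in> A \<Longrightarrow> j \<in> A \<Longrightarrow> i \<notin> B \<or> j \<notin> B \<Longrightarrow> f i j = 0"
  shows "(\<Sum>i\<in>A. \<Sum>j\<in>A. f i j) = (\<Sum>i\<in>B. \<Sum>j\<in>B. f i j)"
  unfolding sum.cartesian_product
  by (rule sum.mono_neutral_right) (use assms in auto)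

text \<open>Coefficients on \<open>I\<close> are transported along \<open>f\<close> and extended by
  zero to \<open>J\<close>. It is applied below to inclusions and to complementation of
  sets.\<close>

lemma psd_on_reindex:
  assumes "psd_on J M" "finite J" "inj_on f I" "f ` I \<subseteq> J"
  shows "psd_on I (\<lambda>i j. M (f i) (f j))"
  unfolding psd_on_def
proof (intro conjI allI ballI)
  fix i j assume "i \<in> I" "j \<in> I"
  then show "M (f i) (f j) = M (f j) (f i)"
    using assms unfolding psd_on_def by blast
next
  fix c :: "'b \<Rightarrow> real"
  define d where "d = (\<lambda>j. if j \<in> f ` I then c (the_inv_into I f j) else 0)"
  have d: "d (f i) = c i" if "i \<in> I" for i
    using that assms(3) by (simp add: d_def the_inv_into_f_f)
  have zero: "d j = 0" if "j \<in> J - f ` I" for j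
    using that by (simp add: d_def)
  have "0 \<le> (\<Sum>i\<in>J. \<Sum>j\<in>J. d i * M i j * d j)"
    using assms(1) unfolding psd_on_def by blast
  also have "\<dots> = (\<Sum>i\<in>f ` I. \<Sum>j\<in>f ` I. d i * M i j * d j)"
    using assms(2,4) zero by (intro sum_sum_mono_neutral_right) auto
  also have "\<dots> = (\<Sum>i\<in>I. \<Sum>j\<in>I. c i * M (f i) (f j) * c j)"
    by (simp add: sum.reindex assms(3) d)
  finally show "0 \<le> (\<Sum>i\<in>I. \<Sum>j\<in>I. c i * M (f i) (f j) * c j)" .
qed

lemma psd_on_subset:
  assumes "psd_on J M" "finite J" "I \<subseteq> J"
  shows "psd_on I M"
  using psd_on_reindex[OF assms(1,2), of "\<lambda>i. i" I] assms(3) by simp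

text \<open>With \<open>M i i = 0\<close>, the quadratic form at \<open>s\<close> times the unit
  vector of \<open>i\<close> plus that of \<open>j\<close> is affine in \<open>s\<close>. Being
  bounded below, it has slope zero.\<close>

lemma psd_on_diagonal_zero:
  assumes psd: "psd_on A M" and "finite A" "i \<in> A" "j \<in> A" "M i i = 0"
  shows "M i j = 0"
proof (cases "i = j")
  case False
  have sym: "M j i = M i j"
    using assms unfolding psd_on_def by blast
  have "0 \<le> M j j + 2 * s * M i j" for s
  proof -
    define c where "c = (\<lambda>k. if k = i then s else if k = j then 1 else 0)"
    have "0 \<le> (\<Sum>k\<in>A. \<Sum>l\<in>A. c k * M k l * c l)"
      using psd unfolding psd_on_def by blast
    also have "\<dots> = (\<Sum>k\<in>{i,j}. \<Sum>l\<in>{i,j}. c k * M k l * c l)"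
      using assms(2-4) by (intro sum_sum_mono_neutral_right) (auto simp: c_def)
    also have "\<dots> = M j j + 2 * s * M i j"
      using False by (simp add: c_def sym assms(5))
    finally show ?thesis .
  qed
  note nonneg = this
  show ?thesis
  proof (rule ccontr)
    assume "M i j \<noteq> 0"
    then have "M j j + 2 * (- (M j j + 1) / (2 * M i j)) * M i j = -1" by (simp add: field_simps)
    with nonneg[of "- (M j j + 1) / (2 * M i j)"] show False by simp
  qed
qed (use assms in simp)

text \<open>One elimination step, phrased through a rank-one vector \<open>w\<close> so that a zero
  pivot needs no separate treatment. A vector orthogonal to \<open>w\<close> does not see the
  subtracted term, and row and column \<open>i\<close> of the remainder vanish, so the entry at
  \<open>i\<close> can be chosen to force orthogonality.\<close>

lemma psd_on_schur_complement:
  assumes psd: "psd_on A M" and fin: "finite A"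
    and w: "\<And>j. j \<in> A \<Longrightarrow> w i * w j = M i j" and w0: "w i = 0 \<Longrightarrow> \<forall>j\<in>A. w j = 0"
    and i: "i \<in> A"
  shows "psd_on (A - {i}) (\<lambda>j k. M j k - w j * w k)"
  unfolding psd_on_def
proof (intro conjI allI ballI)
  fix j k assume "j \<in> A - {i}" "k \<in> A - {i}"
  then show "M j k - w j * w k = M k j - w k * w j"
    using psd unfolding psd_on_def by (simp add: mult.commute)
next
  fix c :: "'a \<Rightarrow> real"
  let ?N = "\<lambda>j k. M j k - w j * w k"
  \<comment> \<open>If \<open>w i = 0\<close>, the quotient is 0 by convention; orthogonality then
    holds because \<open>w\<close> vanishes on \<open>A\<close>.\<close>
  define d where "d = c(i := - (\<Sum>j\<in>A - {i}. c j * w j) / w i)"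
  have "(\<Sum>j\<in>A. d j * w j) = d i * w i + (\<Sum>j\<in>A - {i}. c j * w j)"
    unfolding sum.remove[OF fin i] by (simp add: d_def)
  then have orth: "(\<Sum>j\<in>A. d j * w j) = 0"
    using w0 by (cases "w i = 0") (simp_all add: d_def)
  have Ni: "?N i k = 0" "?N k i = 0" if "k \<in> A" for k
  proof -
    show "?N i k = 0" using w[OF that] by simp
    then show "?N k i = 0"
      using psd i that unfolding psd_on_def by (simp add: mult.commute)
  qed
  have "0 \<le> (\<Sum>j\<in>A. \<Sum>k\<in>A. d j * M j k * d k)"
    using psd unfolding psd_on_def by blast
  also have "\<dots> = (\<Sum>j\<in>A. \<Sum>k\<in>A. d j * ?N j k * d k) + (\<Sum>j\<in>A. d j * w j) * (\<Sum>k\<in>A. d k * w k)"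
    unfolding sum_product sum.distrib[symmetric] by (simp add: algebra_simps)
  also have "\<dots> = (\<Sum>j\<in>A. \<Sum>k\<in>A. d j * ?N j k * d k)"
    by (simp add: orth)
  also have "\<dots> = (\<Sum>j\<in>A - {i}. \<Sum>k\<in>A - {i}. c j * ?N j k * c k)"
    using fin i Ni
    by (simp add: sum.remove[OF fin i] d_def)
  finally show "0 \<le> (\<Sum>j\<in>A - {i}. \<Sum>k\<in>A - {i}. c j * ?N j k * c k)" .
qed

text \<open>
  Eliminating an index of least level causes no fill-in outside the band of width two, and the
  rank-one term split off is supported on indices whose level exceeds the least one by at most two.
\<close>

lemma banded_psd_pairing_nonneg:
  fixes lev :: "'a \<Rightarrow> nat"
  assumes "finite A" and "psd_on A M"
    and "\<And>i j. i \<in> A \<Longrightarrow> j \<in> A \<Longrightarrow> lev j > lev i + 2 \<Longrightarrow> M i j = 0"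
    and "\<And>i. i \<in> A \<Longrightarrow> psd_on {j \<in> A. lev i \<le> lev j \<and> lev j \<le> lev i + 2} Y"
  shows "0 \<le> (\<Sum>i\<in>A. \<Sum>j\<in>A. M i j * Y i j)"
  using assms
proof (induction A arbitrary: M rule: finite_psubset_induct)
  case (psubset A)
  note fin = \<open>finite A\<close> and psd = \<open>psd_on A M\<close>
  show ?case
  proof (cases "A = {}")
    case False
    then obtain i where i: "i \<in> A" and least: "\<And>j. j \<in> A \<Longrightarrow> lev i \<le> lev j"
      using ex_min_if_finite[of "lev ` A"] fin
      by (metis arg_min_if_finite(1) arg_min_least)
    \<comment> \<open>The normalised pivot row. For \<open>M i i = 0\<close> it is the zero vector
      by the convention on division, consistent with row \<open>i\<close> being zero.\<close>
    define w where "w = (\<lambda>j. M i j / sqrt (M i i))"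
    let ?N = "\<lambda>j k. M j k - w j * w k"
    let ?B = "{j \<in> A. lev i \<le> lev j \<and> lev j \<le> lev i + 2}"
    have Mii: "0 \<le> M i i"
    proof -
      have "psd_on {i} M" using psd_on_subset[OF psd fin] i by simp
      then have "0 \<le> (\<Sum>j\<in>{i}. \<Sum>k\<in>{i}. 1 * M j k * 1)"
        unfolding psd_on_def by (elim conjE allE[of _ "\<lambda>_. 1"])
      then show ?thesis by simp
    qed
    have w: "w i * w j = M i j" if "j \<in> A" for j
      using psd_on_diagonal_zero[OF psd fin i that] Mii
      by (cases "M i i = 0") (simp_all add: w_def)
    have w0: "\<forall>j\<in>A. w j = 0" if "w i = 0"
      using psd_on_diagonal_zero[OF psd fin i] that by (auto simp: w_def)
    have w_far: "w k = 0" if "k \<in> A" "lev k > lev i + 2" for k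
      using psubset.prems(2)[OF i that] by (simp add: w_def)
    have psdY: "psd_on ?B Y" by (rule psubset.prems(3)[OF i])
    \<comment> \<open>The split-off rank-one kernel is paired with \<open>Y\<close>: this is the
      quadratic form of \<open>Y\<close> at \<open>w\<close>, whose support in \<open>A\<close> lies
      in \<open>?B\<close>.\<close>
    have "0 \<le> (\<Sum>j\<in>?B. \<Sum>k\<in>?B. w j * Y j k * w k)"
      using psdY unfolding psd_on_def by blast
    also have "\<dots> = (\<Sum>j\<in>A. \<Sum>k\<in>A. w j * Y j k * w k)"
    proof (rule sum_sum_mono_neutral_right[symmetric])
      fix j k assume "j \<in> A" "k \<in> A" "j \<notin> ?B \<or> k \<notin> ?B"
      then have "w j = 0 \<or> w k = 0"
        using w_far[of j] w_far[of k] least[of j] least[of k] by auto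
      then show "w j * Y j k * w k = 0" by auto
    qed (use fin in auto)
    finally have rank1: "0 \<le> (\<Sum>j\<in>A. \<Sum>k\<in>A. w j * Y j k * w k)" .
    have Ni: "?N i k = 0" "?N k i = 0" if "k \<in> A" for k
    proof -
      show "?N i k = 0" using w[OF that] by simp
      then show "?N k i = 0"
        using psd i that unfolding psd_on_def by (simp add: mult.commute)
    qed
    have "0 \<le> (\<Sum>j\<in>A - {i}. \<Sum>k\<in>A - {i}. ?N j k * Y j k)"
    proof (rule psubset.IH)
      show "A - {i} \<subset> A" using i by blast
      show "psd_on (A - {i}) ?N"
        using psd fin w w0 i by (rule psd_on_schur_complement)
      fix j k assume jk: "j \<in> A - {i}" "k \<in> A - {i}" "lev j + 2 < lev k"
      \<comment> \<open>As \<open>lev i\<close> is least, \<open>k\<close> also lies more than two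
        levels above \<open>i\<close>, so \<open>w k = 0\<close> and nothing is subtracted.\<close>
      then show "?N j k = 0"
        using psubset.prems(2)[of j k] w_far[of k] least[of j] by simp
    next
      fix j assume "j \<in> A - {i}"
      then show "psd_on {k \<in> A - {i}. lev j \<le> lev k \<and> lev k \<le> lev j + 2} Y"
        using psubset.prems(3)[of j] fin by (auto elim!: psd_on_subset)
    qed
    also have "\<dots> = (\<Sum>j\<in>A. \<Sum>k\<in>A. ?N j k * Y j k)"
      using Ni by (simp add: sum.remove[OF fin i])
    finally have "0 \<le> (\<Sum>j\<in>A. \<Sum>k\<in>A. ?N j k * Y j k) + (\<Sum>j\<in>A. \<Sum>k\<in>A. w j * Y j k * w k)"
      using rank1 by simp
    also have "\<dots> = (\<Sum>j\<in>A. \<Sum>k\<in>A. M j k * Y j k)"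
      unfolding sum.distrib[symmetric] by (simp add: algebra_simps)
    finally show ?thesis .
  qed simp
qed

subsection \<open>Characters of the hypercube\<close>

text \<open>A subset \<open>A\<close> stands for the vertex of the hypercube that is \<open>-1\<close> exactly on \<open>A\<close>.\<close>

definition sign_vector :: "nat set \<Rightarrow> nat \<Rightarrow> real" where
  "sign_vector A i = (if i \<in> A then -1 else 1)"

definition character :: "nat set \<Rightarrow> nat set \<Rightarrow> real" where
  "character S A = (-1) ^ card (S \<inter> A)"

lemma card_sym_diff:
  assumes "finite S" "finite T"
  shows "card (sym_diff S T) + 2 * card (S \<inter> T) = card S + card T"
proof -
  have "card S = card (S - T) + card (S \<inter> T)" "card T = card (T - S) + card (S \<inter> T)"
    using assms by (metis add.commute card_Int_Diff, metis add.commute card_Int_Diff Int_commute)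
  moreover have "card (sym_diff S T) = card (S - T) + card (T - S)"
    using assms by (intro card_Un_disjoint) auto
  ultimately show ?thesis by simp
qed

lemma even_card_sym_diff:
  assumes "finite S" "finite T"
  shows "even (card (sym_diff S T)) \<longleftrightarrow> (even (card S) \<longleftrightarrow> even (card T))"
  using card_sym_diff[OF assms] by presburger

lemma character_commute: "character S A = character A S"
  by (simp add: character_def Int_commute)

lemma character_sym_diff:
  assumes "finite S" "finite T"
  shows "character (sym_diff S T) A = character S A * character T A"
proof -
  have eq: "sym_diff S T \<inter> A = sym_diff (S \<inter> A) (T \<inter> A)" by blast
  show ?thesis
    using even_card_sym_diff[of "S \<inter> A" "T \<inter> A"] assms
    unfolding character_def eq by (simp add: minus_one_power_iff)
qed

lemma character_empty [simp]: "character {} A = 1"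
  by (simp add: character_def)

lemma character_doubleton:
  assumes "i \<noteq> j"
  shows "character {i, j} A = sign_vector A i * sign_vector A j"
  using assms by (auto simp: character_def sign_vector_def Int_insert_left)

text \<open>Symmetric difference with \<open>S\<close> is an involution of
  \<open>Pow N\<close>.\<close>

lemma sum_sym_diff:
  assumes "S \<subseteq> N"
  shows "(\<Sum>T\<in>Pow N. f (sym_diff S T)) = sum f (Pow N)"
  using assms
  by (intro sum.reindex_bij_witness[where i = "sym_diff S" and j = "sym_diff S"]) auto

text \<open>Toggling an element of a nonempty \<open>U\<close> permutes the vertices and negates the
  character, so the sum equals its own negative.\<close>

lemma sum_character:
  assumes "finite N" "U \<subseteq> N"
  shows "(\<Sum>A\<in>Pow N. character U A) = (if U = {} then 2 ^ card N else 0)"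
proof (cases "U = {}")
  case False
  then obtain i where i: "i \<in> U" by blast
  have "(\<Sum>A\<in>Pow N. character U A) = (\<Sum>A\<in>Pow N. character U (sym_diff {i} A))"
    using i assms by (intro sum_sym_diff[symmetric]) auto
  also have "\<dots> = (\<Sum>A\<in>Pow N. - character U A)"
  proof (rule sum.cong)
    fix A assume "A \<in> Pow N"
    then have "finite A" using assms finite_subset by blast
    then have "character U (sym_diff {i} A) = character {i} U * character A U"
      unfolding character_commute[of U] by (intro character_sym_diff) auto
    also have "character {i} U = -1"
      using i by (simp add: character_def)
    finally show "character U (sym_diff {i} A) = - character U A"
      by (simp add: character_commute)
  qed simp
  finally show ?thesis
    using False by (simp add: sum_negf)
qed (simp add: card_Pow assms)

text \<open>Let \<open>F\<close> be the function with Fourier coefficients \<open>g\<close>. Then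
  \<open>2 ^ card N\<close> times the form at \<open>c\<close> is the sum of \<open>F\<close> times
  the square of the function with coefficients \<open>c\<close>.\<close>

lemma psd_on_convolution_kernel:
  fixes g :: "nat set \<Rightarrow> real"
  assumes fin: "finite N"
    and nonneg: "\<And>A. A \<subseteq> N \<Longrightarrow> 0 \<le> (\<Sum>V\<in>Pow N. g V * character V A)"
  shows "psd_on (Pow N) (\<lambda>S T. g (sym_diff S T))"
  unfolding psd_on_def
proof (intro conjI allI ballI)
  fix S T show "g (sym_diff S T) = g (sym_diff T S)"
    by (simp add: Un_commute)
next
  fix c :: "nat set \<Rightarrow> real"
  define F where "F A = (\<Sum>V\<in>Pow N. g V * character V A)" for A
  have finN: "finite S" if "S \<in> Pow N" for S
    using that fin finite_subset by blast
  \<comment> \<open>Fourier inversion, from orthogonality of the characters.\<close>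
  have coeff: "(\<Sum>A\<in>Pow N. F A * character U A) = 2 ^ card N * g U" if U: "U \<in> Pow N" for U
  proof -
    have "(\<Sum>A\<in>Pow N. F A * character U A)
        = (\<Sum>V\<in>Pow N. g V * (\<Sum>A\<in>Pow N. character V A * character U A))"
      unfolding F_def sum_distrib_left sum_distrib_right
      by (subst sum.swap) (simp add: mult.assoc)
    also have "\<dots> = (\<Sum>V\<in>Pow N. g V * (if V = U then 2 ^ card N else 0))"
    proof (rule sum.cong)
      fix V assume V: "V \<in> Pow N"
      have "(\<Sum>A\<in>Pow N. character V A * character U A) = (\<Sum>A\<in>Pow N. character (sym_diff V U) A)"
        using finN[OF U] finN[OF V] by (simp add: character_sym_diff)
      also have "\<dots> = (if sym_diff V U = {} then 2 ^ card N else 0)"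
        using U V fin by (intro sum_character) auto
      also have "sym_diff V U = {} \<longleftrightarrow> V = U" by blast
      finally show "g V * (\<Sum>A\<in>Pow N. character V A * character U A)
          = g V * (if V = U then 2 ^ card N else 0)" by simp
    qed simp
    also have "\<dots> = 2 ^ card N * g U"
      using U fin by (simp add: if_distrib cong: if_cong)
    finally show ?thesis .
  qed
  have "0 \<le> (\<Sum>A\<in>Pow N. F A * (\<Sum>S\<in>Pow N. c S * character S A)\<^sup>2)"
    using nonneg by (intro sum_nonneg mult_nonneg_nonneg) (auto simp: F_def)
  also have "\<dots> = (\<Sum>A\<in>Pow N. \<Sum>S\<in>Pow N. \<Sum>T\<in>Pow N.
      c S * c T * (F A * character (sym_diff S T) A))"
    by (intro sum.cong refl)
      (simp add: power2_eq_square sum_product sum_distrib_left character_sym_diff finN mult_ac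
        del: Pow_iff)
  also have "\<dots> = (\<Sum>S\<in>Pow N. \<Sum>T\<in>Pow N. \<Sum>A\<in>Pow N.
      c S * c T * (F A * character (sym_diff S T) A))"
    by (subst sum.swap, rule sum.cong[OF refl], rule sum.swap)
  also have "\<dots> = (\<Sum>S\<in>Pow N. \<Sum>T\<in>Pow N. c S * c T * (2 ^ card N * g (sym_diff S T)))"
    unfolding sum_distrib_left[symmetric] by (intro sum.cong refl) (subst coeff, auto)
  also have "\<dots> = 2 ^ card N * (\<Sum>S\<in>Pow N. \<Sum>T\<in>Pow N. c S * g (sym_diff S T) * c T)"
    by (simp add: sum_distrib_left mult_ac)
  finally have "0 \<le> 2 ^ card N * (\<Sum>S\<in>Pow N. \<Sum>T\<in>Pow N. c S * g (sym_diff S T) * c T)" .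
  moreover have "(0::real) < 2 ^ card N" by simp
  ultimately show "0 \<le> (\<Sum>S\<in>Pow N. \<Sum>T\<in>Pow N. c S * g (sym_diff S T) * c T)"
    by (simp only: zero_le_mult_iff) linarith
qed

text \<open>Sets \<open>T\<close> of the other parity have odd symmetric difference with
  \<open>S\<close>, where \<open>h\<close> vanishes. The sum thus extends to all of
  \<open>Pow N\<close>, which translation by \<open>S\<close> permutes.\<close>

lemma sum_parity_class:
  fixes h :: "nat set \<Rightarrow> real"
  assumes fin: "finite N" and supp: "\<And>V. V \<subseteq> N \<Longrightarrow> odd (card V) \<Longrightarrow> h V = 0"
    and S: "S \<subseteq> N" "even (card S) = b"
  shows "(\<Sum>T\<in>{T. T \<subseteq> N \<and> even (card T) = b}. h (sym_diff S T)) = sum h (Pow N)"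
proof -
  have "(\<Sum>T\<in>{T. T \<subseteq> N \<and> even (card T) = b}. h (sym_diff S T))
      = (\<Sum>T\<in>Pow N. h (sym_diff S T))"
  proof (rule sum.mono_neutral_left)
    show "\<forall>T\<in>Pow N - {T. T \<subseteq> N \<and> even (card T) = b}. h (sym_diff S T) = 0"
    proof
      fix T assume T: "T \<in> Pow N - {T. T \<subseteq> N \<and> even (card T) = b}"
      then have "finite S" "finite T" using S fin finite_subset by blast+
      then have "odd (card (sym_diff S T))"
        using even_card_sym_diff T S(2) by blast
      then show "h (sym_diff S T) = 0" using T S(1) by (intro supp) auto
    qed
  qed (use fin in auto)
  also have "\<dots> = sum h (Pow N)" using S(1) by (rule sum_sym_diff)
  finally show ?thesis .
qed

subsection \<open>Pseudo-expectations of nonnegative quadratic functions\<close>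

text \<open>Either the band already lies in the index set of the moment matrix, or the complements
  of its members have at most \<open>card N - k\<close> elements, hence at most
  \<open>t\<close>.\<close>

lemma psd_on_moment_band:
  fixes y :: "nat set \<Rightarrow> real"
  assumes fin: "finite N" and kt: "k + 2 \<le> t \<or> card N \<le> k + t"
    and psd: "psd_on {S. S \<subseteq> N \<and> card S \<le> t} (\<lambda>S T. y (sym_diff S T))"
  shows "psd_on {S. S \<subseteq> N \<and> k \<le> card S \<and> card S \<le> k + 2} (\<lambda>S T. y (sym_diff S T))"
    (is "psd_on ?B _")
proof (cases "k + 2 \<le> t")
  case True
  with fin show ?thesis by (intro psd_on_subset[OF psd]) auto
next
  case False
  with kt have kt: "card N \<le> k + t" by simp
  have "psd_on ?B (\<lambda>S T. y (sym_diff (N - S) (N - T)))"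
  proof (rule psd_on_reindex[OF psd])
    show "inj_on ((-) N) ?B" by (auto simp: inj_on_def)
    show "(-) N ` ?B \<subseteq> {S. S \<subseteq> N \<and> card S \<le> t}"
      using kt fin by (auto simp: card_Diff_subset finite_subset)
  qed (use fin in simp)
  moreover have "sym_diff (N - S) (N - T) = sym_diff S T" if "S \<in> ?B" "T \<in> ?B" for S T
    using that by blast
  ultimately show ?thesis
    unfolding psd_on_def by simp
qed

text \<open>On a single parity class every row of the pairing of \<open>g\<close> with the moment
  matrix has the same sum, namely the pseudo-expectation. The whole pairing is therefore a positive
  multiple of it.\<close>

lemma moment_quadratic_nonneg:
  fixes g y :: "nat set \<Rightarrow> real"
  assumes fin: "finite N" and t: "card N \<le> 2 * t"
    and psd: "psd_on {S. S \<subseteq> N \<and> card S \<le> t} (\<lambda>S T. y (sym_diff S T))"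
    and quadratic: "\<And>V. V \<subseteq> N \<Longrightarrow> card V \<noteq> 0 \<Longrightarrow> card V \<noteq> 2 \<Longrightarrow> g V = 0"
    and nonneg: "\<And>A. A \<subseteq> N \<Longrightarrow> 0 \<le> (\<Sum>V\<in>Pow N. g V * character V A)"
  shows "0 \<le> (\<Sum>V\<in>Pow N. g V * y V)"
proof -
  \<comment> \<open>This parity keeps the band from level \<open>k\<close> to \<open>k + 2\<close> from straddling the middle level.\<close>
  define b where "b = even (card N div 2)"
  define P where "P = {S. S \<subseteq> N \<and> even (card S) = b}"
  have finP: "finite P" and PN: "P \<subseteq> Pow N" using fin by (auto simp: P_def)
  have finS: "finite S" if "S \<in> P" for S using that PN fin finite_subset by blast
  have "0 \<le> (\<Sum>S\<in>P. \<Sum>T\<in>P. g (sym_diff S T) * y (sym_diff S T))"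
  proof (rule banded_psd_pairing_nonneg[where lev = card])
    show "psd_on P (\<lambda>S T. g (sym_diff S T))"
      using psd_on_convolution_kernel[OF fin nonneg] fin PN by (auto elim!: psd_on_subset)
  next
    fix S T assume ST: "S \<in> P" "T \<in> P" "card S + 2 < card T"
    \<comment> \<open>Sizes differing by more than 2 force a symmetric difference of more than 2
      elements, beyond the quadratic terms.\<close>
    then have "card (S \<inter> T) \<le> card S" using finS by (intro card_mono) auto
    then have "card (sym_diff S T) > 2"
      using card_sym_diff[of S T] ST finS by fastforce
    then show "g (sym_diff S T) = 0" using ST PN by (intro quadratic) auto
  next
    fix S assume S: "S \<in> P"
    then have "even (card S) = even (card N div 2)" by (simp add: P_def b_def)
    \<comment> \<open>The only way to fail would be \<open>card S = t - 1\<close> with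
      \<open>card N = 2 * t\<close>, which parity excludes.\<close>
    then have "card S + 2 \<le> t \<or> card N \<le> card S + t" using t by presburger
    from psd_on_moment_band[OF fin this psd]
    show "psd_on {T \<in> P. card S \<le> card T \<and> card T \<le> card S + 2} (\<lambda>S T. y (sym_diff S T))"
      by (rule psd_on_subset) (use fin in \<open>auto simp: P_def\<close>)
  qed (rule finP)
  also have "\<dots> = (\<Sum>S\<in>P. \<Sum>V\<in>Pow N. g V * y V)"
  proof (rule sum.cong)
    fix S assume S: "S \<in> P"
    have "g V * y V = 0" if V: "V \<subseteq> N" "odd (card V)" for V
    proof -
      have "card V \<noteq> 0" "card V \<noteq> 2" using V(2) by (metis even_zero, metis even_numeral)
      with quadratic V(1) show ?thesis by simp
    qed
    then show "(\<Sum>T\<in>P. g (sym_diff S T) * y (sym_diff S T)) = (\<Sum>V\<in>Pow N. g V * y V)"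
      unfolding P_def using fin S[unfolded P_def]
      by (intro sum_parity_class[where h = "\<lambda>V. g V * y V"]) auto
  qed simp
  also have "\<dots> = card P * (\<Sum>V\<in>Pow N. g V * y V)" by simp
  finally have *: "0 \<le> card P * (\<Sum>V\<in>Pow N. g V * y V)" .
  \<comment> \<open>A set of middle size shows that \<open>P\<close> is nonempty, so
    \<open>card P\<close> can be cancelled.\<close>
  obtain S where "S \<subseteq> N" "card S = card N div 2"
    by (rule obtain_subset_with_card_n[of "card N div 2" N]) auto
  then have "S \<in> P" by (simp add: P_def b_def)
  then have "card P > 0" using finP card_gt_0_iff by blast
  then have "real (card P) > 0" by simp
  with * show ?thesis by (simp only: zero_le_mult_iff) linarith
qed

subsection \<open>Separation in spaces of finitely supported functions\<close>

lemma lookup_scaleR: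
  fixes v :: "('a, real) poly_mapping"
  shows "Poly_Mapping.lookup (r *\<^sub>R v) p = r * Poly_Mapping.lookup v p"
proof -
  have "finite {p. r * Poly_Mapping.lookup v p \<noteq> 0}"
    by (rule finite_subset[OF _ finite_keys[of v]]) (auto simp: in_keys_iff)
  then show ?thesis by (simp add: scaleR_poly_mapping_def)
qed

lemma norm_lookup_le:
  fixes v :: "('a, real) poly_mapping"
  shows "norm (Poly_Mapping.lookup v p) \<le> norm v"
proof (cases "p \<in> Poly_Mapping.keys v")
  case True
  have "norm v = (\<Sum>q\<in>Poly_Mapping.keys v. \<bar>Poly_Mapping.lookup v q\<bar>)"
    by (simp add: norm_poly_mapping_def dist_poly_mapping_def)
  then show ?thesis using True
    by (simp add: member_le_sum[where f = "\<lambda>q. \<bar>Poly_Mapping.lookup v q\<bar>"])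
qed (simp add: in_keys_iff)

lemma bounded_linear_lookup:
  "bounded_linear (\<lambda>v. Poly_Mapping.lookup v p :: real)"
  by (rule bounded_linear_intro[where K = 1])
    (use norm_lookup_le in \<open>auto simp: lookup_add lookup_scaleR\<close>)

text \<open>Nearest-point argument in the Euclidean distance of the coordinates \<open>I\<close>:
  the normal \<open>a\<close> points from a nearest point \<open>u\<close> of \<open>K\<close> to
  \<open>l\<close>. The norm of the space is the sum of absolute values, so \<open>q\<close> is
  minimised through continuity of the coordinates.\<close>

lemma separating_functional_compact_convex:
  fixes K :: "('a, real) poly_mapping set"
  assumes K: "compact K" "convex K" "K \<noteq> {}" and I: "finite I"
    and supp: "\<And>v. v \<in> K \<Longrightarrow> Poly_Mapping.keys v \<subseteq> I" "Poly_Mapping.keys l \<subseteq> I" and l: "l \<notin> K"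
  obtains a c where "\<And>v. v \<in> K \<Longrightarrow> (\<Sum>p\<in>I. a p * Poly_Mapping.lookup v p) \<le> c"
    "(\<Sum>p\<in>I. a p * Poly_Mapping.lookup l p) > c"
proof -
  let ?L = Poly_Mapping.lookup
  define q where "q v = (\<Sum>p\<in>I. (?L l p - ?L v p)\<^sup>2)" for v
  have "continuous_on K q"
    unfolding q_def
    by (intro continuous_intros bounded_linear.continuous_on[OF bounded_linear_lookup])
  then obtain u where u: "u \<in> K" and least: "\<And>v. v \<in> K \<Longrightarrow> q u \<le> q v"
    using continuous_attains_inf[OF K(1,3)] by blast
  define a where "a p = ?L l p - ?L u p" for p
  define c where "c = (\<Sum>p\<in>I. a p * ?L u p)"
  show ?thesis
  proof
    fix v assume v: "v \<in> K"
    define s where "s = (\<Sum>p\<in>I. a p * (?L v p - ?L u p))"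
    define r where "r = (\<Sum>p\<in>I. (?L v p - ?L u p)\<^sup>2)"
    have r: "0 \<le> r" unfolding r_def by (intro sum_nonneg) simp
    \<comment> \<open>Moving from \<open>u\<close> towards \<open>v\<close> by \<open>e\<close>
      cannot decrease \<open>q\<close>; expand the squares and divide by \<open>e\<close>.\<close>
    have step: "2 * s \<le> e * r" if e: "0 < e" "e \<le> 1" for e
    proof -
      have "(1 - e) *\<^sub>R u + e *\<^sub>R v \<in> K"
        using e K(2) u v by (intro convexD) auto
      then have "q u \<le> q ((1 - e) *\<^sub>R u + e *\<^sub>R v)" by (rule least)
      also have "\<dots> = (\<Sum>p\<in>I. (a p)\<^sup>2 - 2 * e * (a p * (?L v p - ?L u p)) + e\<^sup>2 * (?L v p - ?L u p)\<^sup>2)"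
        unfolding q_def
        by (intro sum.cong) (auto simp: a_def lookup_add lookup_scaleR power2_eq_square algebra_simps
            simp del: scaleR_left_diff_distrib)
      also have "\<dots> = q u - 2 * e * s + e\<^sup>2 * r"
        by (simp add: sum.distrib sum_subtractf sum_distrib_left[symmetric] q_def a_def s_def r_def)
      finally have "e * (2 * s) \<le> e * (e * r)" by (simp add: power2_eq_square algebra_simps)
      then show ?thesis using e by simp
    qed
    have "s \<le> 0"
    proof (rule ccontr)
      assume "\<not> s \<le> 0"
      then have s: "s > 0" by simp
      \<comment> \<open>Small enough that \<open>e * r \<le> s\<close>, contradicting
        \<open>2 * s \<le> e * r\<close>; the summand 1 guards against \<open>r = 0\<close>.\<close>
      define e where "e = min 1 (s / (r + 1))"
      have e: "0 < e" "e \<le> 1" using s r by (auto simp: e_def)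
      have "e * r \<le> s / (r + 1) * r"
        using r by (intro mult_right_mono) (auto simp: e_def)
      also have "\<dots> \<le> s"
        using r s by (simp add: field_simps)
      finally show False using step[OF e] s by simp
    qed
    then show "(\<Sum>p\<in>I. a p * ?L v p) \<le> c"
      by (simp add: s_def c_def right_diff_distrib sum_subtractf)
  next
    \<comment> \<open>The gap between \<open>l\<close> and \<open>u\<close> is the sum of the
      squares of \<open>a\<close>. It is positive, since otherwise \<open>l\<close> and
      \<open>u\<close> agree on \<open>I\<close> and both vanish elsewhere.\<close>
    have "\<exists>p\<in>I. a p \<noteq> 0"
    proof (rule ccontr)
      assume neg: "\<not> (\<exists>p\<in>I. a p \<noteq> 0)"
      have "?L l p = ?L u p" for p
      proof (cases "p \<in> I")
        case False
        then have "p \<notin> Poly_Mapping.keys l" "p \<notin> Poly_Mapping.keys u" using supp u by blast+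
        then show ?thesis by (simp add: in_keys_iff)
      qed (use neg a_def in auto)
      then have "l = u" by (rule poly_mapping_eqI)
      with u l show False by simp
    qed
    then have "0 < (\<Sum>p\<in>I. (a p)\<^sup>2)"
      using I by (auto intro: sum_pos2)
    also have "\<dots> = (\<Sum>p\<in>I. a p * ?L l p) - c"
      by (simp add: c_def sum_subtractf[symmetric] power2_eq_square a_def algebra_simps)
    finally show "c < (\<Sum>p\<in>I. a p * ?L l p)" by simp
  qed
qed

subsection \<open>The cut polytope\<close>

lemma cut_vector_cong:
  assumes "\<And>i. i \<in> {1..n} \<Longrightarrow> x i = x' i"
  shows "cut_vector n x = cut_vector n x'"
  unfolding cut_vector_def by (rule sum.cong) (use assms in \<open>auto simp: index_pairs_def\<close>)

text \<open>Values of \<open>x\<close> outside \<open>{1..n}\<close> do not affect the cut vector.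
  Indexing vertices by subsets exhibits finitely many generators, whence compactness of the
  hull.\<close>

lemma cut_polytope_altdef:
  "cut_polytope n = convex hull ((\<lambda>A. cut_vector n (sign_vector A)) ` Pow {1..n})"
proof -
  have "cut_vector n ` {x. \<forall>i\<in>{1..n}. x i \<in> {-1, 1}}
      = (\<lambda>A. cut_vector n (sign_vector A)) ` Pow {1..n}" (is "?L = ?R")
  proof
    show "?L \<subseteq> ?R"
    proof
      fix v assume "v \<in> ?L"
      then obtain x where x: "\<forall>i\<in>{1..n}. x i \<in> {-1, 1}" and v: "v = cut_vector n x" by blast
      have "v = cut_vector n (sign_vector {i \<in> {1..n}. x i = -1})"
        unfolding v by (rule cut_vector_cong) (use x in \<open>auto simp: sign_vector_def\<close>)
      then show "v \<in> ?R" by blast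
    qed
    show "?R \<subseteq> ?L" by (auto simp: sign_vector_def)
  qed
  then show ?thesis by (simp add: cut_polytope_def)
qed

lemma keys_cut_vector: "Poly_Mapping.keys (cut_vector n x) \<subseteq> index_pairs n"
  by (auto simp: in_keys_iff lookup_cut_vector split: if_splits)

section \<open>Convexity, and the cut polytope inside every level\<close>

lemma convex_pair_space: "convex (pair_space n)"
proof -
  have "pair_space n = {v. \<forall>p. p \<notin> index_pairs n \<longrightarrow> Poly_Mapping.lookup v p = 0}"
    by (auto simp: pair_space_def in_keys_iff subset_iff)
  then show ?thesis
    by (simp add: convex_def lookup_add lookup_scaleR)
qed

lemma convex_lasserre_cut: "convex (lasserre_cut n t)"
proof (rule convexI)
  fix l m u v assume l: "l \<in> lasserre_cut n t" and m: "m \<in> lasserre_cut n t"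
    and uv: "0 \<le> (u::real)" "0 \<le> v" "u + v = 1"
  let ?I = "{S. S \<subseteq> {1..n} \<and> card S \<le> t}"
  obtain y where y: "l \<in> pair_space n" "y {} = 1"
    "\<forall>(i, j) \<in> index_pairs n. y {i, j} = Poly_Mapping.lookup l (i, j)"
    "psd_on ?I (\<lambda>S T. y (sym_diff S T))"
    using l unfolding lasserre_cut_def by blast
  obtain z where z: "m \<in> pair_space n" "z {} = 1"
    "\<forall>(i, j) \<in> index_pairs n. z {i, j} = Poly_Mapping.lookup m (i, j)"
    "psd_on ?I (\<lambda>S T. z (sym_diff S T))"
    using m unfolding lasserre_cut_def by blast
  have "psd_on ?I (\<lambda>S T. u * y (sym_diff S T) + v * z (sym_diff S T))"
    unfolding psd_on_def
  proof (intro conjI allI ballI)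
    fix c :: "nat set \<Rightarrow> real"
    have "0 \<le> u * (\<Sum>S\<in>?I. \<Sum>T\<in>?I. c S * y (sym_diff S T) * c T)
        + v * (\<Sum>S\<in>?I. \<Sum>T\<in>?I. c S * z (sym_diff S T) * c T)"
      using uv y(4) z(4) unfolding psd_on_def by (intro add_nonneg_nonneg mult_nonneg_nonneg) blast+
    also have "\<dots> = (\<Sum>S\<in>?I. \<Sum>T\<in>?I. c S * (u * y (sym_diff S T) + v * z (sym_diff S T)) * c T)"
      unfolding sum_distrib_left sum.distrib[symmetric] by (simp add: algebra_simps)
    finally show "0 \<le> (\<Sum>S\<in>?I. \<Sum>T\<in>?I. c S * (u * y (sym_diff S T) + v * z (sym_diff S T)) * c T)" .
  qed (simp add: Un_commute)
  moreover have "u *\<^sub>R l + v *\<^sub>R m \<in> pair_space n"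
    using convex_pair_space y(1) z(1) uv by (rule convexD)
  moreover have "u * y {i, j} + v * z {i, j} = Poly_Mapping.lookup (u *\<^sub>R l + v *\<^sub>R m) (i, j)"
    if "(i, j) \<in> index_pairs n" for i j
    using bspec[OF y(3) that] bspec[OF z(3) that] by (simp add: lookup_add lookup_scaleR)
  ultimately show "u *\<^sub>R l + v *\<^sub>R m \<in> lasserre_cut n t"
    using y(2) z(2) uv unfolding lasserre_cut_def
    by (intro CollectI conjI exI[of _ "\<lambda>S. u * y S + v * z S"]) auto
qed

text \<open>The true moments of the vertex \<open>A\<close> are the character values there; by
  multiplicativity their moment matrix has rank one.\<close>

lemma cut_vector_in_lasserre_cut: "cut_vector n (sign_vector A) \<in> lasserre_cut n t"
proof -
  let ?I = "{S. S \<subseteq> {1..n} \<and> card S \<le> t}"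
  have "psd_on ?I (\<lambda>S T. character (sym_diff S T) A)"
    unfolding psd_on_def
  proof (intro conjI allI ballI)
    fix c :: "nat set \<Rightarrow> real"
    have "0 \<le> (\<Sum>S\<in>?I. c S * character S A) * (\<Sum>S\<in>?I. c S * character S A)" by simp
    also have "\<dots> = (\<Sum>S\<in>?I. \<Sum>T\<in>?I. c S * character (sym_diff S T) A * c T)"
      unfolding sum_product
      by (intro sum.cong refl) (auto simp: character_sym_diff finite_subset mult_ac)
    finally show "0 \<le> (\<Sum>S\<in>?I. \<Sum>T\<in>?I. c S * character (sym_diff S T) A * c T)" .
  qed (simp add: Un_commute)
  moreover have "character {i, j} A = Poly_Mapping.lookup (cut_vector n (sign_vector A)) (i, j)"
    if "(i, j) \<in> index_pairs n" for i j
    using that by (auto simp: lookup_cut_vector index_pairs_def intro!: character_doubleton)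
  ultimately show ?thesis
    unfolding lasserre_cut_def pair_space_def using keys_cut_vector
    by (intro CollectI conjI exI[of _ "\<lambda>S. character S A"]) auto
qed

lemma cut_polytope_subset_lasserre_cut: "cut_polytope n \<subseteq> lasserre_cut n t"
  unfolding cut_polytope_altdef
  using cut_vector_in_lasserre_cut convex_lasserre_cut by (intro hull_minimal) auto

section \<open>The reverse inclusion by separation\<close>

lemma sum_quadratic:
  fixes c :: real and a :: "nat \<times> nat \<Rightarrow> real" and h :: "nat set \<Rightarrow> real"
  defines "g \<equiv> (\<lambda>V. if V = {} then c else if card V = 2 then a (Min V, Max V) else 0)"
  shows "(\<Sum>V\<in>Pow {1..n}. g V * h V) = c * h {} + (\<Sum>(i, j)\<in>index_pairs n. a (i, j) * h {i, j})"
proof -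
  let ?f = "\<lambda>(i, j). {i, j} :: nat set"
  have inj: "inj_on ?f (index_pairs n)"
    by (auto simp: inj_on_def index_pairs_def doubleton_eq_iff)
  have ne: "{} \<notin> ?f ` index_pairs n" by auto
  have "(\<Sum>V\<in>Pow {1..n}. g V * h V) = (\<Sum>V\<in>insert {} (?f ` index_pairs n). g V * h V)"
  proof (rule sum.mono_neutral_right)
    show "insert {} (?f ` index_pairs n) \<subseteq> Pow {1..n}" by (auto simp: index_pairs_def)
    show "\<forall>V\<in>Pow {1..n} - insert {} (?f ` index_pairs n). g V * h V = 0"
    proof
      fix V assume V: "V \<in> Pow {1..n} - insert {} (?f ` index_pairs n)"
      have "card V \<noteq> 2"
      proof
        assume "card V = 2"
        then obtain i j where ij: "V = {i, j}" "i < j"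
          by (metis card_2_iff insert_commute linorder_neqE_nat)
        then have "(i, j) \<in> index_pairs n" using V by (auto simp: index_pairs_def)
        then have "V \<in> ?f ` index_pairs n" using ij by force
        with V show False by blast
      qed
      with V show "g V * h V = 0" by (simp add: g_def)
    qed
  qed simp
  also have "\<dots> = g {} * h {} + (\<Sum>p\<in>index_pairs n. g (?f p) * h (?f p))"
    using ne by (subst sum.insert) (auto simp: sum.reindex[OF inj])
  \<comment> \<open>For \<open>i < j\<close>, \<open>Min\<close> and \<open>Max\<close> recover the
    ordered pair from the set \<open>{i, j}\<close>.\<close>
  also have "(\<Sum>p\<in>index_pairs n. g (?f p) * h (?f p)) = (\<Sum>(i, j)\<in>index_pairs n. a (i, j) * h {i, j})"
    by (rule sum.cong) (auto simp: g_def index_pairs_def)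
  finally show ?thesis by (simp add: g_def)
qed

lemma lasserre_cut_subset_cut_polytope:
  assumes t: "n \<le> 2 * t"
  shows "lasserre_cut n t \<subseteq> cut_polytope n"
proof
  fix l assume "l \<in> lasserre_cut n t"
  then obtain y where l: "Poly_Mapping.keys l \<subseteq> index_pairs n" and y: "y {} = 1"
    "\<And>i j. (i, j) \<in> index_pairs n \<Longrightarrow> y {i, j} = Poly_Mapping.lookup l (i, j)"
    "psd_on {S. S \<subseteq> {1..n} \<and> card S \<le> t} (\<lambda>S T. y (sym_diff S T))"
    unfolding lasserre_cut_def pair_space_def by blast
  show "l \<in> cut_polytope n"
  proof (rule ccontr)
    assume notin: "l \<notin> cut_polytope n"
    have supp: "Poly_Mapping.keys v \<subseteq> index_pairs n" if "v \<in> cut_polytope n" for v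
    proof -
      have "cut_polytope n \<subseteq> pair_space n"
        unfolding cut_polytope_def
        using keys_cut_vector convex_pair_space by (intro hull_minimal) (auto simp: pair_space_def)
      then show ?thesis using that by (auto simp: pair_space_def)
    qed
    have "compact (cut_polytope n)" "convex (cut_polytope n)" "cut_polytope n \<noteq> {}"
      unfolding cut_polytope_altdef by (auto intro: finite_imp_compact_convex_hull convex_convex_hull)
    then obtain a c where a: "\<And>v. v \<in> cut_polytope n \<Longrightarrow>
        (\<Sum>p\<in>index_pairs n. a p * Poly_Mapping.lookup v p) \<le> c"
      and c: "(\<Sum>p\<in>index_pairs n. a p * Poly_Mapping.lookup l p) > c"
      using separating_functional_compact_convex[OF _ _ _ finite_index_pairs supp l notin] by metis
    \<comment> \<open>Fourier coefficients of the slack of the separating inequality, a quadratic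
      function nonnegative at every vertex.\<close>
    define g where "g = (\<lambda>V. if V = {} then c else if card V = 2 then - a (Min V, Max V) else 0)"
    have sum_g: "(\<Sum>V\<in>Pow {1..n}. g V * h V)
        = c * h {} - (\<Sum>(i, j)\<in>index_pairs n. a (i, j) * h {i, j})" for h
      unfolding g_def using sum_quadratic[of c "\<lambda>p. - a p" h n]
      by (simp add: case_prod_unfold sum_negf)
    have "0 \<le> (\<Sum>V\<in>Pow {1..n}. g V * y V)"
    proof (rule moment_quadratic_nonneg[OF _ _ y(3)])
      fix A assume "A \<subseteq> {1..n}"
      then have "cut_vector n (sign_vector A) \<in> cut_polytope n"
        unfolding cut_polytope_altdef by (intro hull_inc) auto
      from a[OF this]
      have "(\<Sum>p\<in>index_pairs n. a p * Poly_Mapping.lookup (cut_vector n (sign_vector A)) p) \<le> c" .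
      also have "(\<Sum>p\<in>index_pairs n. a p * Poly_Mapping.lookup (cut_vector n (sign_vector A)) p)
          = (\<Sum>(i, j)\<in>index_pairs n. a (i, j) * character {i, j} A)"
        by (rule sum.cong) (auto simp: lookup_cut_vector character_doubleton index_pairs_def)
      finally show "0 \<le> (\<Sum>V\<in>Pow {1..n}. g V * character V A)"
        unfolding sum_g by simp
    next
      fix V :: "nat set" assume "V \<subseteq> {1..n}" "card V \<noteq> 0" "card V \<noteq> 2"
      then show "g V = 0" by (auto simp: g_def)
    qed (use t in auto)
    \<comment> \<open>Since \<open>y {} = 1\<close>, the pseudo-expectation is the slack at
      \<open>l\<close>, which separation makes negative.\<close>
    also have "\<dots> = c - (\<Sum>p\<in>index_pairs n. a p * Poly_Mapping.lookup l p)"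
      unfolding sum_g by (auto simp: y intro!: sum.cong)
    finally show False using c by simp
  qed
qed

theorem mainTheorem4:
  fixes n :: nat
  assumes "n \<ge> 1"
  shows "lasserre_cut n (nat \<lceil>real n / 2\<rceil>) = cut_polytope n"
proof
  have "real n / 2 \<le> real (nat \<lceil>real n / 2\<rceil>)" by linarith
  then have "n \<le> 2 * nat \<lceil>real n / 2\<rceil>" by linarith
  then show "lasserre_cut n (nat \<lceil>real n / 2\<rceil>) \<subseteq> cut_polytope n"
    by (rule lasserre_cut_subset_cut_polytope)
qed (rule cut_polytope_subset_lasserre_cut)

end
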